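(* Let $\mathcal{H}$ be a real Hilbert space. Let $A_i\colon\mathcal{H}\rightrightarrows\mathcal{H}$ be set-valued operators and $\sigma_i\in\mathbb{R}$ for $i\in\{1,\dots,n\}$ with $\sigma:=\sum_{i=1}^n\sigma_i>0$. Let $q\in\mathcal{H}$ and $\theta>0$. Then $$J_{\frac{\theta}{\sigma}\left(\sum_{i=1}^nA_i\right)}(q)=\left\{\theta x+q : x\in\operatorname{zer}\left(\sum_{i=1}^n((A_i)_{-q})^{(\theta,\sigma_i)}\right)\right\}.$$ Consequently, if each $A_i$ is $\alpha_i$-monotone (with $\alpha_i\in\mathbb{R}$), $\sum_{i=1}^n(\theta\alpha_i+\sigma_i)>0$ and $q\in\operatorname{ran}\left(\mathrm{Id}+\frac{\theta}{\sigma}\sum_{i=1}^nA_i\right)$, then $J_{\frac{\theta}{\sigma}\left(\sum_{i=1}^nA_i\right)}(q)$ is a singleton and $\frac{1}{\theta}\left(J_{\frac{\theta}{\sigma}\left(\sum_{i=1}^nA_i\right)}(q)-q\right)$ is the unique element of $\operatorname{zer}\left(\sum_{i=1}^n((A_i)_{-q})^{(\theta,\sigma_i)}\right)$.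
   Context: A set-valued operator $A\colon\mathcal{H}\rightrightarrows\mathcal{H}$ maps each $x$ to a (possibly empty) subset $A(x)\subseteq\mathcal{H}$; $\operatorname{gra}A=\{(x,u):u\in A(x)\}$, $\operatorname{ran}A=\{u:\exists x,\ u\in A(x)\}$, $\operatorname{zer}A=\{x:0\in A(x)\}$, and $x\in A^{-1}(u)\iff u\in A(x)$. Sums of set-valued operators are pointwise Minkowski sums. The resolvent of $A$ with parameter $\gamma>0$ is the set-valued operator $J_{\gamma A}:=(\mathrm{Id}+\gamma A)^{-1}$. In an abuse of notation, a singleton $\{u\}$ is identified with $u$. For $\alpha\in\mathbb{R}$, $A$ is $\alpha$-monotone if $\langle x-y,u-v\rangle\ge\alpha\|x-y\|^2$ for all $(x,u),(y,v)\in\operatorname{gra}A$. The inner $w$-perturbation of $A$ is $A_w(x):=A(x-w)$, and the $(\theta,\sigma)$-strengthening of $A$ is $A^{(\theta,\sigma)}:=A\circ(\theta\,\mathrm{Id})+\sigma\,\mathrm{Id}$. Hence $(A_{-q})^{(\theta,\sigma)}(x)=A(\theta x+q)+\sigma x$. *)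

theory Defs
  imports
    "HOL-Analysis.Analysis"
    "HOL-Library.Set_Algebras"
    "HOL-Library.Function_Algebras"
begin

text \<open>
  Set-valued operators are functions into sets. With the instances of \<open>Set_Algebras\<close> and
  \<open>Function_Algebras\<close>, addition and finite sums of operators are pointwise Minkowski sums; the
  neutral element is \<open>\<lambda>x. {0}\<close>, and a sum is empty at every point where one summand is empty.
\<close>

type_synonym 'a set_op = "'a \<Rightarrow> 'a set"

definition gra :: "'a set_op \<Rightarrow> ('a \<times> 'a) set" where
  "gra A = {(x, u). u \<in> A x}"

definition ran_op :: "'a set_op \<Rightarrow> 'a set" where
  "ran_op A = {u. \<exists>x. u \<in> A x}"

definition zer :: "'a::zero set_op \<Rightarrow> 'a set" where
  "zer A = {x. 0 \<in> A x}"

definition inv_op :: "'a set_op \<Rightarrow> 'a set_op" where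
  "inv_op A u = {x. u \<in> A x}"

definition scale_op :: "real \<Rightarrow> 'a::real_vector set_op \<Rightarrow> 'a set_op" where
  "scale_op c A x = (\<lambda>u. c *\<^sub>R u) ` A x"

definition id_op :: "'a set_op" where
  "id_op x = {x}"

definition resolvent :: "real \<Rightarrow> 'a::real_vector set_op \<Rightarrow> 'a set_op" where
  "resolvent \<gamma> A = inv_op (id_op + scale_op \<gamma> A)"

definition alpha_monotone :: "real \<Rightarrow> 'a::real_inner set_op \<Rightarrow> bool" where
  "alpha_monotone \<alpha> A \<longleftrightarrow>
     (\<forall>(x, u) \<in> gra A. \<forall>(y, v) \<in> gra A. (x - y) \<bullet> (u - v) \<ge> \<alpha> * (norm (x - y))\<^sup>2)"

definition inner_pert :: "'a::real_vector \<Rightarrow> 'a set_op \<Rightarrow> 'a set_op" where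
  "inner_pert w A x = A (x - w)"

definition strengthening :: "real \<Rightarrow> real \<Rightarrow> 'a::real_vector set_op \<Rightarrow> 'a set_op" where
  "strengthening \<theta> \<sigma> A = (A \<circ> (\<lambda>x. \<theta> *\<^sub>R x)) + scale_op \<sigma> id_op"

lemma plus_op_iff: "w \<in> (A + B) x \<longleftrightarrow> (\<exists>u\<in>A x. \<exists>v\<in>B x. w = u + v)"
  for A B :: "'a::ab_group_add set_op"
  by (auto simp: set_plus_def)

lemma sum_op_apply: "(\<Sum>i\<in>I. A i) x = (\<Sum>i\<in>I. A i x)"
  for A :: "'i \<Rightarrow> 'a::ab_group_add set_op"
  by (induction I rule: infinite_finite_induct) auto

lemma inner_pert_strengthening_apply:
  "strengthening \<theta> \<sigma> (inner_pert (- q) A) x = A (\<theta> *\<^sub>R x + q) + {\<sigma> *\<^sub>R x}"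
  by (simp add: strengthening_def inner_pert_def scale_op_def id_op_def)

end

(* The substitution p = \<theta> x + q turns q \<in> p + (\<theta>/\<sigma>) B p, with B the sum of the A_i,
   into -\<sigma> x \<in> B (\<theta> x + q), which says that x is a zero of the sum of the strengthenings.
   Two zeros x, y then satisfy (\<theta> \<alpha> + \<sigma>) * |x - y|^2 \<le> 0, where \<alpha> is the sum of the
   \<alpha>_i, because monotonicity constants add up. *)
theory Submission
  imports Defs
begin

lemma alpha_monotoneI:
  assumes "\<And>x u y v. u \<in> A x \<Longrightarrow> v \<in> A y \<Longrightarrow> \<alpha> * (norm (x - y))\<^sup>2 \<le> (x - y) \<bullet> (u - v)"
  shows "alpha_monotone \<alpha> A"
  using assms by (auto simp: alpha_monotone_def gra_def)

lemma alpha_monotoneD: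
  assumes "alpha_monotone \<alpha> A" "u \<in> A x" "v \<in> A y"
  shows "\<alpha> * (norm (x - y))\<^sup>2 \<le> (x - y) \<bullet> (u - v)"
  using assms by (auto simp: alpha_monotone_def gra_def)

text \<open>The second \<open>0\<close> is the operator with constant value \<open>{0}\<close>,
  which is the sum over an empty or infinite index set. It starts the induction for sums.\<close>

lemma alpha_monotone_zero: "alpha_monotone 0 0"
  by (rule alpha_monotoneI) simp

lemma alpha_monotone_add:
  assumes A: "alpha_monotone \<alpha> A" and B: "alpha_monotone \<beta> B"
  shows "alpha_monotone (\<alpha> + \<beta>) (A + B)"
proof (rule alpha_monotoneI)
  fix x u y v
  assume "u \<in> (A + B) x" "v \<in> (A + B) y"
  then obtain a b c d where "a \<in> A x" "b \<in> B x" "u = a + b" "c \<in> A y" "d \<in> B y" "v = c + d"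
    unfolding plus_op_iff by blast
  with alpha_monotoneD[OF A, of a x c y] alpha_monotoneD[OF B, of b x d y]
  show "(\<alpha> + \<beta>) * (norm (x - y))\<^sup>2 \<le> (x - y) \<bullet> (u - v)"
    by (simp add: inner_diff_right inner_add_right algebra_simps)
qed

lemma alpha_monotone_sum:
  assumes "\<And>i. i \<in> I \<Longrightarrow> alpha_monotone (\<alpha> i) (A i)"
  shows "alpha_monotone (\<Sum>i\<in>I. \<alpha> i) (\<Sum>i\<in>I. A i)"
  using assms
  by (induction I rule: infinite_finite_induct) (simp_all add: alpha_monotone_zero alpha_monotone_add)

lemma sum_singleton: "(\<Sum>i\<in>I. {f i}) = {\<Sum>i\<in>I. f i}"
  by (induction I rule: infinite_finite_induct) (simp_all add: set_plus_def)

text \<open>All strengthenings share \<theta> and q, so every \<open>A i\<close> is evaluated at the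
  same point. The Minkowski sum then splits into the sum of the \<open>A i\<close> there and a sum
  of singletons, which is again a singleton and can be moved to the other side.\<close>

lemma zer_sum_strengthening_iff:
  "x \<in> zer (\<Sum>i\<in>I. strengthening \<theta> (\<sigma> i) (inner_pert (- q) (A i)))
     \<longleftrightarrow> - ((\<Sum>i\<in>I. \<sigma> i) *\<^sub>R x) \<in> (\<Sum>i\<in>I. A i) (\<theta> *\<^sub>R x + q)"
proof -
  have "(\<Sum>i\<in>I. strengthening \<theta> (\<sigma> i) (inner_pert (- q) (A i))) x
      = (\<Sum>i\<in>I. A i) (\<theta> *\<^sub>R x + q) + {(\<Sum>i\<in>I. \<sigma> i) *\<^sub>R x}"
    by (simp add: sum_op_apply inner_pert_strengthening_apply sum.distrib sum_singleton
        scaleR_left.sum)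
  then have "x \<in> zer (\<Sum>i\<in>I. strengthening \<theta> (\<sigma> i) (inner_pert (- q) (A i)))
      \<longleftrightarrow> (\<exists>u \<in> (\<Sum>i\<in>I. A i) (\<theta> *\<^sub>R x + q). u + (\<Sum>i\<in>I. \<sigma> i) *\<^sub>R x = 0)"
    by (simp add: zer_def set_plus_def eq_commute[of 0])
  then show ?thesis
    by (metis eq_neg_iff_add_eq_0)
qed

lemma resolvent_iff:
  "p \<in> resolvent \<gamma> B q \<longleftrightarrow> (\<exists>u\<in>B p. q = p + \<gamma> *\<^sub>R u)"
  by (simp add: resolvent_def inv_op_def plus_op_iff id_op_def scale_op_def
      del: plus_fun_apply)

text \<open>The parameter \<theta> / \<sigma> is the one that makes \<theta> x a multiple of
  \<sigma> x by the same factor as u. This nonzero factor cancels.\<close>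

lemma resolvent_affine_iff:
  assumes "\<sigma> \<noteq> 0" "\<theta> \<noteq> 0"
  shows "\<theta> *\<^sub>R x + q \<in> resolvent (\<theta> / \<sigma>) B q \<longleftrightarrow> - (\<sigma> *\<^sub>R x) \<in> B (\<theta> *\<^sub>R x + q)"
proof -
  \<comment> \<open>The resolvent equation determines u, so the existential in
    \<open>resolvent_iff\<close> collapses to a membership.\<close>
  have "q = \<theta> *\<^sub>R x + q + (\<theta> / \<sigma>) *\<^sub>R u \<longleftrightarrow> u = - (\<sigma> *\<^sub>R x)" for u
  proof -
    have "\<theta> *\<^sub>R x + (\<theta> / \<sigma>) *\<^sub>R u = (\<theta> / \<sigma>) *\<^sub>R (\<sigma> *\<^sub>R x + u)"
      using assms by (simp add: scaleR_add_right)
    then have "\<theta> *\<^sub>R x + (\<theta> / \<sigma>) *\<^sub>R u = 0 \<longleftrightarrow> \<sigma> *\<^sub>R x + u = 0"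
      using assms by simp
    moreover have "q = \<theta> *\<^sub>R x + q + (\<theta> / \<sigma>) *\<^sub>R u \<longleftrightarrow> \<theta> *\<^sub>R x + (\<theta> / \<sigma>) *\<^sub>R u = 0"
      by (simp add: add.assoc add.left_commute[of _ q])
    ultimately show ?thesis
      by (simp add: eq_neg_iff_add_eq_0 add.commute)
  qed
  then show ?thesis
    by (auto simp: resolvent_iff)
qed

theorem proposition3:
  fixes A :: "nat \<Rightarrow> ('a::{real_inner, complete_space}) set_op"
    and \<sigma>i :: "nat \<Rightarrow> real" and \<sigma> \<theta> :: real and n :: nat and q :: 'a
  assumes "\<sigma> = (\<Sum>i = 1..n. \<sigma>i i)" and "\<sigma> > 0" and "\<theta> > 0"
  shows "resolvent (\<theta> / \<sigma>) (\<Sum>i = 1..n. A i) q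
           = {\<theta> *\<^sub>R x + q | x.
               x \<in> zer (\<Sum>i = 1..n. strengthening \<theta> (\<sigma>i i) (inner_pert (- q) (A i)))}
       \<and> (\<forall>\<alpha> :: nat \<Rightarrow> real.
            (\<forall>i \<in> {1..n}. alpha_monotone (\<alpha> i) (A i)) \<longrightarrow>
            (\<Sum>i = 1..n. \<theta> * \<alpha> i + \<sigma>i i) > 0 \<longrightarrow>
            q \<in> ran_op (id_op + scale_op (\<theta> / \<sigma>) (\<Sum>i = 1..n. A i)) \<longrightarrow>
            (\<exists>p. resolvent (\<theta> / \<sigma>) (\<Sum>i = 1..n. A i) q = {p}
               \<and> zer (\<Sum>i = 1..n. strengthening \<theta> (\<sigma>i i) (inner_pert (- q) (A i)))
                   = {(1 / \<theta>) *\<^sub>R (p - q)}))"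
proof -
  define B where "B = (\<Sum>i = 1..n. A i)"
  define Z where "Z = zer (\<Sum>i = 1..n. strengthening \<theta> (\<sigma>i i) (inner_pert (- q) (A i)))"
  have Z_iff: "x \<in> Z \<longleftrightarrow> - (\<sigma> *\<^sub>R x) \<in> B (\<theta> *\<^sub>R x + q)" for x
    unfolding Z_def B_def assms(1) by (rule zer_sum_strengthening_iff)
  have J_iff: "\<theta> *\<^sub>R x + q \<in> resolvent (\<theta> / \<sigma>) B q \<longleftrightarrow> x \<in> Z" for x
    using assms(2,3) by (simp add: resolvent_affine_iff Z_iff)
  have J_eq: "resolvent (\<theta> / \<sigma>) B q = {\<theta> *\<^sub>R x + q | x. x \<in> Z}"
  proof (intro set_eqI iffI)
    fix p
    assume p: "p \<in> resolvent (\<theta> / \<sigma>) B q"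
    \<comment> \<open>The substitution is onto: since \<theta> is nonzero, every p has a preimage x.
      Hence \<open>J_iff\<close> covers the whole resolvent.\<close>
    have "p = \<theta> *\<^sub>R ((1 / \<theta>) *\<^sub>R (p - q)) + q"
      using assms(3) by simp
    with p J_iff show "p \<in> {\<theta> *\<^sub>R x + q | x. x \<in> Z}"
      by (metis (mono_tags, lifting) mem_Collect_eq)
  qed (use J_iff in blast)
  have "\<exists>p. resolvent (\<theta> / \<sigma>) B q = {p} \<and> Z = {(1 / \<theta>) *\<^sub>R (p - q)}"
    if mono: "\<forall>i \<in> {1..n}. alpha_monotone (\<alpha> i) (A i)"
      and pos: "(\<Sum>i = 1..n. \<theta> * \<alpha> i + \<sigma>i i) > 0"
      and ran: "q \<in> ran_op (id_op + scale_op (\<theta> / \<sigma>) B)" for \<alpha>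
  proof -
    define a where "a = (\<Sum>i = 1..n. \<alpha> i)"
    have B_mono: "alpha_monotone a B"
      unfolding a_def B_def using mono by (intro alpha_monotone_sum) simp
    have pos': "\<theta> * a + \<sigma> > 0"
      using pos by (simp add: a_def assms(1) sum.distrib sum_distrib_left)
    have uniq: "x = y" if "x \<in> Z" "y \<in> Z" for x y
    proof -
      \<comment> \<open>In the difference of the two points q cancels and leaves \<theta> (x - y);
        the values given by \<open>Z_iff\<close> differ by -\<sigma> (x - y).\<close>
      have "a * (norm (\<theta> *\<^sub>R (x - y)))\<^sup>2 \<le> \<theta> *\<^sub>R (x - y) \<bullet> - (\<sigma> *\<^sub>R (x - y))"
        using alpha_monotoneD[OF B_mono that[unfolded Z_iff]] by (simp add: scaleR_diff_right)
      \<comment> \<open>The left side carries \<theta>^2 from the squared norm and the right side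
        only \<theta>, so one factor \<theta> comes out and \<theta> a + \<sigma> remains.\<close>
      then have "\<theta> * ((\<theta> * a + \<sigma>) * (norm (x - y))\<^sup>2) \<le> 0"
        by (simp add: power_mult_distrib dot_square_norm distrib_left distrib_right
            power2_eq_square[of \<theta>] mult_ac)
      with assms(3) pos' have "(norm (x - y))\<^sup>2 \<le> 0"
        by (simp add: mult_le_0_iff)
      then show ?thesis by simp
    qed
    \<comment> \<open>Monotonicity gives only uniqueness. Existence is the range condition, which
      says that the resolvent is nonempty at q.\<close>
    obtain p where "p \<in> resolvent (\<theta> / \<sigma>) B q"
      using ran by (auto simp: ran_op_def resolvent_def inv_op_def)
    then obtain x where "x \<in> Z"
      unfolding J_eq by blast
    with uniq have Z_eq: "Z = {x}" by blast
    then have "resolvent (\<theta> / \<sigma>) B q = {\<theta> *\<^sub>R x + q}"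
      unfolding J_eq by blast
    with Z_eq assms(3) show ?thesis by simp
  qed
  with J_eq show ?thesis
    unfolding B_def Z_def by blast
qed

end
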